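(* There exists $\delta>0$ such that for every $\alpha\in(0,\delta)$ and every $b_1\in(-\delta,0)$ the complex vector space of entire analytic functions $u:\mathbb{C}\to\mathbb{C}$ satisfying $u\,e^{-F}\in L_2(\mathbb{C})$ is infinite-dimensional, where $F=F_{\alpha,b_1}$ is the solution, defined in the context, of the Poisson equation $\Delta F=B$ with the sector field $B$ equal to $2b_1$ in a sector of angle $\alpha$ and equal to $2$ in the complementary sector.
   Context: Identify $\mathbb{R}^2$ with $\mathbb{C}$ by $z=x_1+ix_2$; $L_2(\mathbb{C})$ is taken with respect to Lebesgue measure. For $0<\alpha<\pi$ let $\Omega_1=\{z\neq 0:\arg z\in(0,\alpha)\}$ and let $\Omega_2$ be the complementary sector. Let $b_1<0$ and (by normalization) $b_2=1$. The field is $B=2b_1$ in $\Omega_1$ and $B=2b_2=2$ in $\Omega_2$. Put $c_0=1-b_1$ and let $\phi(z)=b_1x_2^2$ for $z\in\Omega_1$, $\phi(z)=x_2^2$ for $z\in\Omega_2$. Let $\log z$ denote the branch of the logarithm continuous in $\mathbb{C}\setminus L_\alpha$, $L_\alpha=\{\arg z=\alpha\}$ (together with the origin), with imaginary part in $[\alpha,\alpha+2\pi)$. The potential is $$F(z)=\phi(z)-\frac{c_0\sin\alpha}{2\pi}\,\mathrm{Re}\left(\left(ze^{-i\alpha/2}\right)^2\log z\right).$$ The function $F$ (extended by continuity to $L_\alpha$ and to the origin) is continuously differentiable and satisfies $\Delta F=B$ in the sense of distributions. *)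

theory Defs
  imports "HOL-Complex_Analysis.Complex_Analysis" "HOL-Library.Function_Algebras"
begin

section \<open>The potential of the sector field\<close>

definition sector :: "real \<Rightarrow> complex set" where
  "sector \<alpha> = {z. z \<noteq> 0 \<and> 0 < Arg z \<and> Arg z < \<alpha>}"

text \<open>
  Since \<open>Arg2pi\<close> takes its values in \<open>[0, 2\<pi>)\<close>, the imaginary part below lies in
  \<open>[\<alpha>, \<alpha> + 2\<pi>)\<close>; the cut is the ray \<open>arg z = \<alpha>\<close>.
\<close>

definition log_branch :: "real \<Rightarrow> complex \<Rightarrow> complex" where
  "log_branch \<alpha> z = Complex (ln (cmod z)) (\<alpha> + Arg2pi (z * cis (- \<alpha>)))"

definition sector_phi :: "real \<Rightarrow> real \<Rightarrow> complex \<Rightarrow> real" where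
  "sector_phi \<alpha> b1 z = (if z \<in> sector \<alpha> then b1 * (Im z)\<^sup>2 else (Im z)\<^sup>2)"

text \<open>
  On the cut and at the origin the values given by the formula are those of the continuous
  extension, see \<open>continuous_on_sector_potential\<close> below. (At the origin \<open>ln 0 = 0\<close> is irrelevant
  because of the factor \<open>z\<^sup>2\<close>.)
\<close>

definition sector_potential :: "real \<Rightarrow> real \<Rightarrow> complex \<Rightarrow> real" where
  "sector_potential \<alpha> b1 z =
     sector_phi \<alpha> b1 z
       - (1 - b1) * sin \<alpha> / (2 * pi) * Re ((z * cis (- \<alpha> / 2))\<^sup>2 * log_branch \<alpha> z)"

section \<open>Square integrability and dimension\<close>

definition in_L2 :: "(complex \<Rightarrow> complex) \<Rightarrow> bool" where
  "in_L2 f \<longleftrightarrow> f \<in> borel_measurable lebesgue \<and> integrable lebesgue (\<lambda>z. (cmod (f z))\<^sup>2)"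

definition zero_modes :: "(complex \<Rightarrow> real) \<Rightarrow> (complex \<Rightarrow> complex) set" where
  "zero_modes F = {u. u holomorphic_on UNIV \<and> in_L2 (\<lambda>z. u z * of_real (exp (- F z)))}"

definition fun_scale :: "complex \<Rightarrow> (complex \<Rightarrow> complex) \<Rightarrow> complex \<Rightarrow> complex" where
  "fun_scale c u = (\<lambda>z. c * u z)"

interpretation cfun: vector_space fun_scale
  by unfold_locales (auto simp: fun_scale_def fun_eq_iff algebra_simps)

text \<open>The library's \<open>dim\<close> is a natural number and does not detect infinite dimension.\<close>

definition infinite_dimensional :: "(complex \<Rightarrow> complex) set \<Rightarrow> bool" where
  "infinite_dimensional V \<longleftrightarrow> cfun.subspace V \<and> \<not> (\<exists>B. finite B \<and> B \<subseteq> V \<and> V \<subseteq> cfun.span B)"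

section \<open>Consistency of the definitions\<close>

lemma exp_log_branch:
  assumes "z \<noteq> 0"
  shows "exp (log_branch \<alpha> z) = z"
proof -
  have "z * cis (- \<alpha>) = of_real (cmod z) * cis (Arg2pi (z * cis (- \<alpha>)))"
    using Arg2pi_eq[of "z * cis (- \<alpha>)"] by (simp add: norm_mult cis_conv_exp)
  then have "z * cis (- \<alpha>) * cis \<alpha> = of_real (cmod z) * cis (Arg2pi (z * cis (- \<alpha>))) * cis \<alpha>"
    by simp
  then have "z = of_real (cmod z) * cis (\<alpha> + Arg2pi (z * cis (- \<alpha>)))"
    by (simp add: mult.assoc cis_mult add.commute)
  then show ?thesis
    using assms by (simp add: log_branch_def exp_eq_polar exp_of_real)
qed

lemma Im_log_branch: "\<alpha> \<le> Im (log_branch \<alpha> z)" "Im (log_branch \<alpha> z) < \<alpha> + 2 * pi"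
  using Arg2pi_ge_0[of "z * cis (- \<alpha>)"] Arg2pi_lt_2pi[of "z * cis (- \<alpha>)"]
  by (simp_all add: log_branch_def)

lemma sector_iff:
  assumes "0 < \<alpha>" "\<alpha> < pi"
  shows "z \<in> sector \<alpha> \<longleftrightarrow> Im z > 0 \<and> Im (z * cis (- \<alpha>)) < 0"
proof (cases "z = 0")
  case True
  then show ?thesis by (simp add: sector_def)
next
  case False
  define t where "t = Arg z"
  have t: "- pi < t" "t \<le> pi"
    using Arg_bounded[of z] by (auto simp: t_def)
  have z: "z = of_real (cmod z) * cis t"
    using rcis_cmod_Arg[of z] by (simp add: t_def rcis_def)
  have im: "Im z = cmod z * sin t"
    by (subst z) simp
  have "z * cis (- \<alpha>) = of_real (cmod z) * cis (t - \<alpha>)"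
    by (subst z) (simp add: mult.assoc cis_mult)
  then have imw: "Im (z * cis (- \<alpha>)) = cmod z * sin (t - \<alpha>)"
    by simp
  have r: "cmod z > 0" using False by simp
  have "0 < t \<and> t < \<alpha> \<longleftrightarrow> sin t > 0 \<and> sin (t - \<alpha>) < 0"
  proof
    assume a: "0 < t \<and> t < \<alpha>"
    then have "sin t > 0" using assms by (intro sin_gt_zero) auto
    moreover have "sin (\<alpha> - t) > 0" using a assms by (intro sin_gt_zero) auto
    moreover have "sin (t - \<alpha>) = - sin (\<alpha> - t)"
      using sin_minus[of "\<alpha> - t"] by simp
    ultimately show "sin t > 0 \<and> sin (t - \<alpha>) < 0" by simp
  next
    assume a: "sin t > 0 \<and> sin (t - \<alpha>) < 0"
    have "t > 0"
    proof (rule ccontr)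
      assume "\<not> t > 0"
      then have "sin (- t) \<ge> 0" using t by (intro sin_ge_zero) auto
      then show False using a by simp
    qed
    moreover have "t < \<alpha>"
    proof (rule ccontr)
      assume "\<not> t < \<alpha>"
      then have "sin (t - \<alpha>) \<ge> 0" using t assms by (intro sin_ge_zero) auto
      then show False using a by simp
    qed
    ultimately show "0 < t \<and> t < \<alpha>" by simp
  qed
  then show ?thesis
    using False r by (simp only: sector_def mem_Collect_eq im imw t_def[symmetric])
      (auto simp: zero_less_mult_iff mult_less_0_iff)
qed

lemma log_branch_Ln_minus:
  assumes "z * cis (- \<alpha>) \<notin> \<real>\<^sub>\<ge>\<^sub>0"
  shows "log_branch \<alpha> z = Ln (- (z * cis (- \<alpha>))) + \<i> * of_real (\<alpha> + pi)"
proof -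
  have "z \<noteq> 0" using assms by auto
  have "Arg2pi (z * cis (- \<alpha>)) > 0"
    using Arg2pi_ge_0[of "z * cis (- \<alpha>)"] Arg2pi_eq_0[of "z * cis (- \<alpha>)"] assms
    by (force simp: complex_nonneg_Reals_iff complex_is_Real_iff)
  define v where "v = - (z * cis (- \<alpha>))"
  have "v \<noteq> 0" "cmod v = cmod z"
    using \<open>z \<noteq> 0\<close> by (auto simp: v_def norm_mult)
  moreover have "log_branch \<alpha> z = Complex (ln (cmod z)) (\<alpha> + (Im (Ln v) + pi))"
    using Arg2pi_Ln[OF \<open>Arg2pi (z * cis (- \<alpha>)) > 0\<close>] by (simp only: log_branch_def v_def)
  ultimately show ?thesis
    unfolding v_def[symmetric] by (simp add: complex_eq_iff)
qed

lemma log_branch_Ln: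
  assumes "Re (z * cis (- \<alpha>)) > 0"
  shows "log_branch \<alpha> z = Ln (z * cis (- \<alpha>)) + \<i> * of_real \<alpha>
           + (if Im (z * cis (- \<alpha>)) < 0 then 2 * pi * \<i> else 0)"
proof -
  define w where "w = z * cis (- \<alpha>)"
  have w: "w \<noteq> 0" "Re w > 0" using assms by (auto simp: w_def)
  have n: "cmod w = cmod z" by (simp add: w_def norm_mult)
  have b: "\<bar>Im (Ln w)\<bar> < pi / 2" using Re_Ln_pos_lt[OF w(1)] w(2) by simp
  have "Arg2pi w = Im (Ln w) + (if Im w < 0 then 2 * pi else 0)"
  proof (rule Arg2pi_unique)
    show "cmod w > 0" using w by simp
    show "of_real (cmod w) * exp (\<i> * of_real (Im (Ln w) + (if Im w < 0 then 2 * pi else 0))) = w"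
    proof -
      have "cis (Im (Ln w) + (if Im w < 0 then 2 * pi else 0)) = cis (Im (Ln w))"
        by (simp add: cis_mult[symmetric])
      moreover have "of_real (cmod w) * cis (Im (Ln w)) = w"
        using exp_Ln[OF w(1)] w by (simp add: exp_eq_polar[of "Ln w"] exp_of_real)
      ultimately show ?thesis by (simp only: cis_conv_exp)
    qed
    show "0 \<le> Im (Ln w) + (if Im w < 0 then 2 * pi else 0)"
      using b w Im_Ln_pos_le[of w] by auto
    show "Im (Ln w) + (if Im w < 0 then 2 * pi else 0) < 2 * pi"
      using b w Im_Ln_pos_le[of w] by auto
  qed
  then show ?thesis
    unfolding log_branch_def w_def[symmetric] using w n by (simp add: complex_eq_iff)
qed

lemma isCont_sector_potential_0: "isCont (sector_potential \<alpha> b1) 0"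
proof -
  define c where "c = \<bar>(1 - b1) * sin \<alpha> / (2 * pi)\<bar>"
  define K where "K = \<bar>\<alpha>\<bar> + 2 * pi"
  define g where "g = (\<lambda>z::complex. (\<bar>b1\<bar> + 1) * (cmod z)\<^sup>2 + c * (cmod z + K * (cmod z)\<^sup>2))"
  have "isCont g 0" unfolding g_def by (intro continuous_intros)
  then have g: "(g \<longlongrightarrow> 0) (at 0)" by (simp add: isCont_def g_def)
  have "\<bar>sector_potential \<alpha> b1 z\<bar> \<le> g z" if z: "z \<noteq> 0" "cmod z < 1" for z
  proof -
    have "(Im z)\<^sup>2 \<le> (cmod z)\<^sup>2"
      using abs_Im_le_cmod[of z] by (simp add: abs_le_square_iff[symmetric])
    moreover have "\<bar>sector_phi \<alpha> b1 z\<bar> \<le> (\<bar>b1\<bar> + 1) * (Im z)\<^sup>2"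
      by (auto simp: sector_phi_def abs_mult algebra_simps)
    ultimately have 1: "\<bar>sector_phi \<alpha> b1 z\<bar> \<le> (\<bar>b1\<bar> + 1) * (cmod z)\<^sup>2"
      by (smt (verit) mult_left_mono abs_ge_zero)
    have "ln (1 / cmod z) \<le> 1 / cmod z - 1"
      using z by (intro ln_le_minus_one) auto
    then have l: "\<bar>ln (cmod z)\<bar> \<le> 1 / cmod z"
      using z by (simp add: ln_div)
    have "cmod (log_branch \<alpha> z) \<le> \<bar>Re (log_branch \<alpha> z)\<bar> + \<bar>Im (log_branch \<alpha> z)\<bar>"
      by (rule cmod_le)
    also have "\<dots> \<le> 1 / cmod z + K"
      using l Im_log_branch[of \<alpha> z] by (auto simp: log_branch_def K_def)
    finally have "(cmod z)\<^sup>2 * cmod (log_branch \<alpha> z) \<le> (cmod z)\<^sup>2 * (1 / cmod z + K)"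
      by (intro mult_left_mono) auto
    also have "\<dots> = cmod z + K * (cmod z)\<^sup>2"
      using z by (simp add: field_simps power2_eq_square)
    finally have "\<bar>Re ((z * cis (- \<alpha> / 2))\<^sup>2 * log_branch \<alpha> z)\<bar> \<le> cmod z + K * (cmod z)\<^sup>2"
      using abs_Re_le_cmod[of "(z * cis (- \<alpha> / 2))\<^sup>2 * log_branch \<alpha> z"]
      by (simp add: norm_mult norm_power)
    then have "c * \<bar>Re ((z * cis (- \<alpha> / 2))\<^sup>2 * log_branch \<alpha> z)\<bar> \<le> c * (cmod z + K * (cmod z)\<^sup>2)"
      by (intro mult_left_mono) (auto simp: c_def)
    then show ?thesis
      using 1 unfolding sector_potential_def g_def c_def abs_mult[symmetric] by linarith
  qed
  then have "\<forall>\<^sub>F z in at 0. norm (sector_potential \<alpha> b1 z) \<le> g z"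
    unfolding eventually_at by (intro exI[of _ 1]) (auto simp: dist_norm)
  then have "(sector_potential \<alpha> b1 \<longlongrightarrow> 0) (at 0)"
    using g by (rule Lim_null_comparison)
  moreover have "sector_potential \<alpha> b1 0 = 0"
    by (simp add: sector_potential_def sector_phi_def)
  ultimately show ?thesis by (simp add: isCont_def)
qed

lemma continuous_on_sector_potential:
  assumes \<alpha>: "0 < \<alpha>" "\<alpha> < pi"
  shows "continuous_on UNIV (sector_potential \<alpha> b1)"
proof -
  define W where "W = (\<lambda>z. z * cis (- \<alpha>))"
  define P where "P = (\<lambda>z. (z * cis (- \<alpha> / 2))\<^sup>2)"
  define c where "c = (1 - b1) * sin \<alpha> / (2 * pi)"
  define L where "L = (\<lambda>z. Ln (- W z) + \<i> * of_real (\<alpha> + pi))"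
  define U1 where "U1 = {z. Im (W z) < 0}"
  define U2 where "U2 = {z. Im (W z) > 0} \<union> {z. Im z < 0}"
  define U3 where "U3 = {z. Re (W z) > 0} \<inter> {z. Im z > 0}"
  have W_def': "W z = z * cis (- \<alpha>)" for z by (simp only: W_def)
  have F: "sector_potential \<alpha> b1 z = sector_phi \<alpha> b1 z - c * Re (P z * log_branch \<alpha> z)" for z
    by (simp add: sector_potential_def c_def P_def)
  have s: "z \<in> sector \<alpha> \<longleftrightarrow> Im z > 0 \<and> Im (W z) < 0" for z
    using sector_iff[OF \<alpha>] by (simp add: W_def)
  have sp: "sin \<alpha> > 0" using \<alpha> by (simp add: sin_gt_zero)
  have WI: "Im z = Re (W z) * sin \<alpha> + Im (W z) * cos \<alpha>" for z
  proof -
    have "z = W z * cis \<alpha>" by (simp add: W_def mult.assoc cis_mult)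
    then show ?thesis by (metis cis.sel mult.commute add.commute times_complex.sel(2))
  qed
  have cW [continuous_intros]: "continuous_on S W" for S
    unfolding W_def by (intro continuous_intros)
  have cP [continuous_intros]: "continuous_on S P" for S
    unfolding P_def by (intro continuous_intros)
  have o: "open U1" "open U2" "open U3"
    unfolding U1_def U2_def U3_def
    by (intro open_Un open_Int open_Collect_less continuous_intros)+
  have L1: "- W z \<notin> \<real>\<^sub>\<le>\<^sub>0" "W z \<notin> \<real>\<^sub>\<ge>\<^sub>0" if "z \<in> U1 \<union> U2" for z
  proof -
    show "W z \<notin> \<real>\<^sub>\<ge>\<^sub>0"
    proof
      assume "W z \<in> \<real>\<^sub>\<ge>\<^sub>0"
      then have "Im (W z) = 0" "Re (W z) \<ge> 0" by (auto simp: complex_nonneg_Reals_iff)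
      then show False using that WI[of z] sp by (auto simp: U1_def U2_def mult_less_0_iff)
    qed
    then show "- W z \<notin> \<real>\<^sub>\<le>\<^sub>0"
      by (auto simp: complex_nonneg_Reals_iff complex_nonpos_Reals_iff)
  qed
  have cL: "continuous_on S L" if "S \<subseteq> U1 \<union> U2" for S
    unfolding L_def using that L1 by (intro continuous_intros) auto
  have lb: "log_branch \<alpha> z = L z" if "z \<in> U1 \<union> U2" for z
    using log_branch_Ln_minus[of z \<alpha>] L1[OF that] by (simp add: L_def W_def)
  have "continuous_on U1 (\<lambda>z. (Im z)\<^sup>2 + (b1 - 1) * (max 0 (Im z))\<^sup>2 - c * Re (P z * L z))"
    by (intro continuous_intros cL) auto
  moreover have "sector_potential \<alpha> b1 z = (Im z)\<^sup>2 + (b1 - 1) * (max 0 (Im z))\<^sup>2 - c * Re (P z * L z)"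
    if "z \<in> U1" for z
    using that lb[of z] by (auto simp: F sector_phi_def s U1_def algebra_simps max_def)
  ultimately have 1: "continuous_on U1 (sector_potential \<alpha> b1)"
    by (simp cong: continuous_on_cong)
  have "continuous_on U2 (\<lambda>z. (Im z)\<^sup>2 - c * Re (P z * L z))"
    by (intro continuous_intros cL) auto
  moreover have "sector_potential \<alpha> b1 z = (Im z)\<^sup>2 - c * Re (P z * L z)" if "z \<in> U2" for z
    using that lb[of z] by (auto simp: F sector_phi_def s U2_def)
  ultimately have 2: "continuous_on U2 (sector_potential \<alpha> b1)"
    by (simp cong: continuous_on_cong)
  define G where "G = (\<lambda>z. (Im z)\<^sup>2 - c * Re (P z * (Ln (W z) + \<i> * of_real \<alpha>))
                             - (1 - b1) * (min 0 (Im (W z)))\<^sup>2)"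
  have "continuous_on U3 G"
    unfolding G_def by (intro continuous_intros) (auto simp: U3_def complex_nonpos_Reals_iff)
  moreover have "sector_potential \<alpha> b1 z = G z" if z: "z \<in> U3" for z
  proof (cases "Im (W z) < 0")
    case False
    then have "log_branch \<alpha> z = Ln (W z) + \<i> * of_real \<alpha>"
      using z log_branch_Ln[of z \<alpha>, folded W_def'] by (simp add: U3_def)
    then show ?thesis
      using False by (simp add: F sector_phi_def s G_def)
  next
    case True
    have "P z = z\<^sup>2 * cis (- \<alpha>)"
      by (simp add: P_def power_mult_distrib Complex.DeMoivre)
    then have ImP: "Im (P z) = Im (z\<^sup>2 * cis (- \<alpha>))" by simp
    have key: "(Im z)\<^sup>2 - sin \<alpha> * Im (P z) = (Im (W z))\<^sup>2"
    proof -
      have "(cos \<alpha>)\<^sup>2 = 1 - (sin \<alpha>)\<^sup>2" by (rule cos_squared_eq)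
      then show ?thesis
        unfolding ImP W_def by (simp add: power2_eq_square) algebra
    qed
    have "sector_potential \<alpha> b1 z
            = b1 * (Im z)\<^sup>2 - c * Re (P z * (Ln (W z) + \<i> * of_real \<alpha>)) + c * (2 * pi) * Im (P z)"
    proof -
      have "log_branch \<alpha> z = Ln (W z) + \<i> * of_real \<alpha> + 2 * pi * \<i>"
        using True z log_branch_Ln[of z \<alpha>, folded W_def'] by (simp add: U3_def)
      then show ?thesis
        using True z by (simp add: F sector_phi_def s U3_def algebra_simps)
    qed
    also have "c * (2 * pi) = (1 - b1) * sin \<alpha>" by (simp add: c_def)
    finally have e: "sector_potential \<alpha> b1 z
        = b1 * (Im z)\<^sup>2 - c * Re (P z * (Ln (W z) + \<i> * of_real \<alpha>))
          + (1 - b1) * sin \<alpha> * Im (P z)" .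
    have "(1 - b1) * (min 0 (Im (W z)))\<^sup>2 = (1 - b1) * ((Im z)\<^sup>2 - sin \<alpha> * Im (P z))"
      using True key by simp
    also have "\<dots> = (1 - b1) * (Im z)\<^sup>2 - (1 - b1) * sin \<alpha> * Im (P z)"
      by (simp add: right_diff_distrib)
    finally show ?thesis
      unfolding e G_def by (simp only: left_diff_distrib)
  qed
  ultimately have 3: "continuous_on U3 (sector_potential \<alpha> b1)"
    by (simp cong: continuous_on_cong)
  show ?thesis
  proof (rule continuous_at_imp_continuous_on, rule ballI)
    fix z :: complex
    have "z \<in> U1 \<union> U2 \<union> U3" if "z \<noteq> 0"
    proof (rule ccontr)
      assume "z \<notin> U1 \<union> U2 \<union> U3"
      then have a: "Im (W z) = 0" "Im z \<ge> 0" "\<not> (Re (W z) > 0 \<and> Im z > 0)"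
        by (auto simp: U1_def U2_def U3_def)
      have "W z \<noteq> 0" using that by (simp add: W_def)
      then have "Re (W z) \<noteq> 0" using a(1) complex_eq_iff[of "W z" 0] by simp
      then show False using a WI[of z] sp by (auto simp: zero_le_mult_iff zero_less_mult_iff)
    qed
    then show "isCont (sector_potential \<alpha> b1) z"
      using isCont_sector_potential_0 o 1 2 3 by (cases "z = 0") (auto simp: continuous_on_eq_continuous_at)
  qed
qed

lemma in_L2_add:
  assumes "in_L2 f" "in_L2 g"
  shows "in_L2 (\<lambda>z. f z + g z)"
proof -
  note [measurable] = assms[unfolded in_L2_def, THEN conjunct1]
  have "integrable lebesgue (\<lambda>z. 2 * (cmod (f z))\<^sup>2 + 2 * (cmod (g z))\<^sup>2)"
    using assms by (simp add: in_L2_def)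
  then have "integrable lebesgue (\<lambda>z. (cmod (f z + g z))\<^sup>2)"
  proof (rule Bochner_Integration.integrable_bound)
    show "AE z in lebesgue. norm ((cmod (f z + g z))\<^sup>2) \<le> norm (2 * (cmod (f z))\<^sup>2 + 2 * (cmod (g z))\<^sup>2)"
    proof (rule AE_I2)
      fix z
      have "(cmod (f z + g z))\<^sup>2 \<le> (cmod (f z) + cmod (g z))\<^sup>2"
        by (intro power_mono norm_triangle_ineq) auto
      also have "\<dots> \<le> 2 * (cmod (f z))\<^sup>2 + 2 * (cmod (g z))\<^sup>2"
        using sum_squares_bound[of "cmod (f z)" "cmod (g z)"] by (simp add: power2_sum)
      finally show "norm ((cmod (f z + g z))\<^sup>2) \<le> norm (2 * (cmod (f z))\<^sup>2 + 2 * (cmod (g z))\<^sup>2)"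
        by simp
    qed
  qed measurable
  then show ?thesis by (simp add: in_L2_def)
qed

lemma subspace_zero_modes: "cfun.subspace (zero_modes F)"
proof (rule cfun.subspaceI)
  show "0 \<in> zero_modes F"
    by (auto simp: zero_modes_def in_L2_def zero_fun_def)
  show "u + v \<in> zero_modes F" if "u \<in> zero_modes F" "v \<in> zero_modes F" for u v
    using that in_L2_add[of "\<lambda>z. u z * of_real (exp (- F z))" "\<lambda>z. v z * of_real (exp (- F z))"]
    by (auto simp: zero_modes_def plus_fun_def distrib_right intro: holomorphic_intros)
  show "fun_scale c u \<in> zero_modes F" if "u \<in> zero_modes F" for c u
    using that
    by (auto simp: zero_modes_def in_L2_def fun_scale_def mult.assoc norm_mult power_mult_distrib
        intro!: holomorphic_intros simp del: of_real_exp)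
qed

end

theory Submission
  imports Defs "HOL-Probability.Distributions"
begin

text \<open>
  Put \<open>c = (1 - b1) sin \<alpha> / (2 \<pi>)\<close>, \<open>a = c / 2\<close> and \<open>w = z exp (- i \<alpha> / 2)\<close>. The entire function
  \<open>1 / \<Gamma>(a w\<^sup>2)\<close> satisfies \<open>|1 / \<Gamma>(s)| \<le> C exp (K |s| - Re s ln |s|)\<close>, which cancels the unbounded factor
  \<open>c Re (w\<^sup>2) ln |z|\<close> of the potential up to an error \<open>(K a + |a ln a| + O(c)) |z|\<^sup>2\<close>, small with \<open>\<alpha>\<close>.
  Moreover \<open>|exp (- z\<^sup>2 / 2)| exp (- y\<^sup>2) = exp (- |z|\<^sup>2 / 2)\<close>, and \<open>y\<^sup>2 - \<phi>\<close> is at most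
  \<open>(1 - b1) \<alpha>\<^sup>2 |z|\<^sup>2\<close> because \<open>|y| \<le> \<alpha> |z|\<close> in the sector. So
  \<open>z\<^sup>n exp (- z\<^sup>2 / 2) / \<Gamma>(a w\<^sup>2)\<close> is a zero mode for every \<open>n\<close>.
\<close>

section \<open>Growth of the reciprocal Gamma function\<close>

text \<open>Factor by factor, |z + n|^2 = (Re z + n)^2 + (Im z)^2, and Re z + n \<ge> n + 1 lets the
  second term be absorbed into 1 + t^2/(n+1)^2. A square root of this factor is given away so that
  the product is the partial sine product at \<open>\<i> * t\<close>.\<close>

lemma norm_pochhammer_le:
  fixes z :: complex
  assumes "Re z \<ge> 1" "\<bar>Im z\<bar> \<le> t"
  shows "cmod (pochhammer z n) \<le> pochhammer (Re z) n * (\<Prod>k=1..n. 1 + t\<^sup>2 / (real k)\<^sup>2)"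
proof (induction n)
  case (Suc n)
  have x: "real (Suc n) \<le> Re z + real n" using assms by simp
  have q: "1 \<le> 1 + t\<^sup>2 / (real (Suc n))\<^sup>2" by simp
  have "(Im z)\<^sup>2 \<le> t\<^sup>2"
    using assms(2) by (metis abs_le_square_iff abs_ge_self order_trans)
  also have "t\<^sup>2 = (real (Suc n))\<^sup>2 * (t\<^sup>2 / (real (Suc n))\<^sup>2)" by simp
  also have "\<dots> \<le> (Re z + real n)\<^sup>2 * (t\<^sup>2 / (real (Suc n))\<^sup>2)"
    using x by (intro mult_right_mono power_mono) auto
  finally have "(cmod (z + of_nat n))\<^sup>2 \<le> (Re z + real n)\<^sup>2 * (1 + t\<^sup>2 / (real (Suc n))\<^sup>2)"
    by (simp add: cmod_power2 distrib_left)
  also have "\<dots> \<le> (Re z + real n)\<^sup>2 * (1 + t\<^sup>2 / (real (Suc n))\<^sup>2)\<^sup>2"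
    using q by (intro mult_left_mono self_le_power) auto
  also have "\<dots> = ((Re z + real n) * (1 + t\<^sup>2 / (real (Suc n))\<^sup>2))\<^sup>2"
    by (simp add: power_mult_distrib)
  finally have "cmod (z + of_nat n) \<le> (Re z + real n) * (1 + t\<^sup>2 / (real (Suc n))\<^sup>2)"
    by (rule power2_le_imp_le) (use x q in auto)
  then have "cmod (pochhammer z n) * cmod (z + of_nat n)
      \<le> (pochhammer (Re z) n * (\<Prod>k=1..n. 1 + t\<^sup>2 / (real k)\<^sup>2))
          * ((Re z + real n) * (1 + t\<^sup>2 / (real (Suc n))\<^sup>2))"
    using Suc.IH assms by (intro mult_mono) (auto intro!: mult_nonneg_nonneg prod_nonneg pochhammer_nonneg)
  then show ?case
    by (simp add: pochhammer_Suc norm_mult mult_ac)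
qed simp

text \<open>Euler's limit is compared at z and at Re z: the denominators agree in modulus, the
  Pochhammer symbols differ by at most a partial sine product, whose limit is of size exp (pi |Im
  z|). On the real interval [1, 2], \<open>rGamma\<close> is bounded by compactness.\<close>

lemma norm_rGamma_strip:
  obtains C where "C > 0"
    and "\<And>z::complex. 1 \<le> Re z \<Longrightarrow> Re z \<le> 2 \<Longrightarrow> cmod (rGamma z) \<le> C * exp (pi * cmod z)"
proof -
  have "compact (rGamma ` {1..2::real})"
    by (intro compact_continuous_image continuous_intros) auto
  then have "bounded (rGamma ` {1..2::real})" by (rule compact_imp_bounded)
  then obtain M where M: "\<And>x. x \<in> {1..2::real} \<Longrightarrow> \<bar>rGamma x\<bar> \<le> M"
    by (force simp: bounded_iff)
  have "M \<ge> 0" using M[of 1] by simp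
  show thesis
  proof (rule that[of "(M + 1) * exp pi"])
    show "(M + 1) * exp pi > 0" using \<open>M \<ge> 0\<close> by simp
    fix z :: complex assume z: "1 \<le> Re z" "Re z \<le> 2"
    \<comment> \<open>The maximum with 1 gives pi t \<ge> 1, so this factor of the sine product can
      be inserted for free and no division by \<open>t\<close> is required.\<close>
    define t where "t = max 1 \<bar>Im z\<bar>"
    have t: "t \<ge> 1" "\<bar>Im z\<bar> \<le> t" by (auto simp: t_def)
    define Q where "Q = (\<lambda>n. \<Prod>k=1..n. 1 + t\<^sup>2 / (real k)\<^sup>2)"
    define w where "w = \<i> * complex_of_real t"
    have "(\<lambda>n. cmod (of_real pi * w * (\<Prod>k=1..n. 1 - w^2 / of_nat k^2))) \<longlonglongrightarrow> cmod (sin (of_real pi * w))"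
      by (intro tendsto_norm sin_product_formula_complex)
    also have "(\<lambda>n. cmod (of_real pi * w * (\<Prod>k=1..n. 1 - w^2 / of_nat k^2))) = (\<lambda>n. pi * t * Q n)"
    proof
      fix n
      have "(\<Prod>k=1..n. 1 - w^2 / of_nat k^2) = of_real (Q n)"
        by (simp add: w_def Q_def power_mult_distrib)
      moreover have "Q n \<ge> 0" unfolding Q_def by (intro prod_nonneg) auto
      ultimately show "cmod (of_real pi * w * (\<Prod>k=1..n. 1 - w^2 / of_nat k^2)) = pi * t * Q n"
        using t by (simp add: norm_mult w_def)
    qed
    \<comment> \<open>The index is shifted because \<open>rGamma_series z n\<close> contains
      \<open>pochhammer z (n + 1)\<close>.\<close>
    finally have l1: "(\<lambda>n. pi * t * Q (n + 1)) \<longlonglongrightarrow> cmod (sin (of_real pi * w))"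
      by (rule LIMSEQ_ignore_initial_segment)
    have s: "cmod (sin (of_real pi * w)) \<le> exp (pi * t)"
    proof -
      \<comment> \<open>This is sin (i x) = i sinh x at x = pi t.\<close>
      have "sin (of_real pi * w) = \<i> * (of_real (exp (pi * t)) - of_real (exp (- (pi * t)))) / 2"
        by (simp add: sin_exp_eq' w_def exp_of_real[symmetric] mult_ac)
      then have "cmod (sin (of_real pi * w)) = \<bar>exp (pi * t) - exp (- (pi * t))\<bar> / 2"
        by (simp only: norm_mult norm_divide of_real_diff[symmetric] norm_of_real) simp
      also have "\<bar>exp (pi * t) - exp (- (pi * t))\<bar> \<le> exp (pi * t) + exp (- (pi * t))"
        by (rule order_trans[OF abs_triangle_ineq4]) simp
      also have "exp (- (pi * t)) \<le> exp (pi * t)" using t by simp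
      finally show ?thesis by simp
    qed
    have l2: "(\<lambda>n. rGamma_series (Re z) n * (pi * t * Q (n + 1)))
        \<longlonglongrightarrow> rGamma (Re z) * cmod (sin (of_real pi * w))"
      by (intro tendsto_mult l1 rGamma_series_LIMSEQ)
    have "cmod (rGamma z) \<le> rGamma (Re z) * cmod (sin (of_real pi * w))"
    proof (rule LIMSEQ_le[OF tendsto_norm[OF rGamma_series_LIMSEQ[of z]] l2], intro exI[of _ 0] allI impI)
      fix n
      have "pi * t \<ge> 1 * 1" using t pi_gt3 by (intro mult_mono) auto
      have Q0: "Q (n + 1) \<ge> 0" unfolding Q_def by (intro prod_nonneg) auto
      have P0: "pochhammer (Re z) (n + 1) \<ge> 0" using z by (intro pochhammer_nonneg) auto
      have "cmod (pochhammer z (n + 1)) \<le> pochhammer (Re z) (n + 1) * Q (n + 1)"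
        unfolding Q_def by (rule norm_pochhammer_le) (use z t in auto)
      also have "Q (n + 1) \<le> pi * t * Q (n + 1)"
        using mult_right_mono[OF \<open>pi * t \<ge> 1 * 1\<close> Q0] by simp
      finally have "cmod (pochhammer z (n + 1)) \<le> pochhammer (Re z) (n + 1) * (pi * t * Q (n + 1))"
        using P0 by (simp add: mult_left_mono)
      then show "cmod (rGamma_series z n) \<le> rGamma_series (Re z) n * (pi * t * Q (n + 1))"
        by (simp add: rGamma_series_def norm_divide norm_mult divide_right_mono)
    qed
    also have "\<dots> \<le> M * exp (pi * t)"
      using M[of "Re z"] z s \<open>M \<ge> 0\<close> by (intro mult_mono) auto
    \<comment> \<open>From t \<le> 1 + |z|; the 1 accounts for the factor \<open>exp pi\<close> in
      the constant.\<close>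
    also have "\<dots> \<le> (M + 1) * exp (pi * (1 + cmod z))"
      using \<open>M \<ge> 0\<close> abs_Im_le_cmod[of z] by (intro mult_mono) (auto simp: t_def)
    finally show "cmod (rGamma z) \<le> (M + 1) * exp pi * exp (pi * cmod z)"
      by (simp add: distrib_left distrib_right exp_add mult_ac)
  qed
qed

text \<open>One term of the exponential series. It replaces Stirling's lower bound for n! below, and
  later absorbs the factor \<open>z ^ n\<close> into a Gaussian.\<close>

lemma pow_le_fact_exp:
  fixes t :: real
  assumes "t \<ge> 0"
  shows "t ^ n \<le> fact n * exp t"
proof -
  have "t ^ n /\<^sub>R fact n \<le> exp t"
    using sum_le_suminf[of "\<lambda>k. t ^ k /\<^sub>R fact k" "{n}"] exp_converges[of t] assms
    by (simp add: sums_iff)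
  then show ?thesis by (simp add: field_simps)
qed

lemma norm_pochhammer_ge_fact:
  fixes z :: complex
  assumes "Re z \<ge> 1"
  shows "fact n \<le> cmod (pochhammer z n)"
proof (induction n)
  case (Suc n)
  have "real (Suc n) \<le> cmod (z + of_nat n)"
    using assms complex_Re_le_cmod[of "z + of_nat n"] by simp
  with Suc.IH have "fact n * real (Suc n) \<le> cmod (pochhammer z n) * cmod (z + of_nat n)"
    by (intro mult_mono) auto
  then show ?case by (simp add: pochhammer_Suc norm_mult mult_ac)
qed simp

lemma norm_pochhammer_le_power:
  fixes z :: complex
  shows "cmod (pochhammer z n) \<le> (cmod z + real n) ^ n"
proof -
  have "cmod (pochhammer z n) = (\<Prod>k<n. cmod (z + of_nat k))"
    by (simp add: pochhammer_prod prod_norm atLeast0LessThan)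
  also have "\<dots> \<le> (\<Prod>k<n. cmod z + real n)"
  proof (rule prod_mono)
    fix k assume "k \<in> {..<n}"
    then show "0 \<le> cmod (z + of_nat k) \<and> cmod (z + of_nat k) \<le> cmod z + real n"
      using norm_triangle_ineq[of z "of_nat k"] by simp
  qed
  finally show ?thesis by simp
qed

lemma exp_ln_power: "x > 0 \<Longrightarrow> exp (real n * ln x) = x ^ n"
  by (simp add: exp_of_nat_mult)

text \<open>The functional equation moves s by an integer n into the strip 1 \<le> Re \<le> 2. To
  the right of the strip one divides by a Pochhammer symbol of modulus at least |s|^n exp (-|s|); to
  the left one multiplies by one of modulus at most (exp 4 |s|)^n. Since n is |Re s| up to a bounded
  error, the power of |s| is exp (- Re s ln |s|) up to exp (O(|s|)).\<close>

lemma norm_rGamma_le: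
  obtains C K where "C > 0" "K > 0"
    and "\<And>s::complex. cmod s \<ge> 1 \<Longrightarrow> cmod (rGamma s) \<le> C * exp (K * cmod s - Re s * ln (cmod s))"
proof -
  obtain C where C: "C > 0"
    and strip: "\<And>z::complex. 1 \<le> Re z \<Longrightarrow> Re z \<le> 2 \<Longrightarrow> cmod (rGamma z) \<le> C * exp (pi * cmod z)"
    using norm_rGamma_strip by blast
  \<comment> \<open>A coarse choice. Beyond - Re s ln |s|, the case Re s < 1 costs at most (2 pi +
    6)|s| + 2 pi + 8, the case Re s \<ge> 1 at most (pi + 3)|s|; both use ln |s| \<le> |s|.\<close>
  define K where "K = 4 * pi + 20"
  show thesis
  proof (rule that[of "C * exp K" K])
    show "C * exp K > 0" "K > 0" using C by (auto simp: K_def add_pos_pos)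
    fix s :: complex assume s: "cmod s \<ge> 1"
    define l where "l = ln (cmod s)"
    have l: "0 \<le> l" "l \<le> cmod s"
      using s ln_le_minus_one[of "cmod s"] ln_ge_zero[of "cmod s"] unfolding l_def by linarith+
    have lpow: "exp (real n * l) = cmod s ^ n" for n
      unfolding l_def by (rule exp_ln_power) (use s in linarith)
    show "cmod (rGamma s) \<le> C * exp K * exp (K * cmod s - Re s * ln (cmod s))"
    proof (cases "Re s \<ge> 1")
      case True
      \<comment> \<open>Subtracting this n brings the real part into [1, 2).\<close>
      define n where "n = nat (\<lfloor>Re s\<rfloor> - 1)"
      have n: "real n = of_int \<lfloor>Re s\<rfloor> - 1" using True by (simp add: n_def le_floor_iff)
      define z where "z = s - of_nat n"
      have z: "1 \<le> Re z" "Re z \<le> 2" "Im z = Im s" "s = z + of_nat n"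
        using n by (auto simp: z_def) linarith+
      have "cmod z \<le> cmod s"
        using z n by (auto simp: cmod_def intro!: real_sqrt_le_mono power_mono)
      have p0: "fact n \<le> cmod (pochhammer z n)" using z by (intro norm_pochhammer_ge_fact)
      have "cmod s ^ n \<le> cmod (pochhammer z n) * exp (cmod s)"
        using pow_le_fact_exp[of "cmod s" n] mult_right_mono[OF p0, of "exp (cmod s)"]
        by (auto intro: order_trans)
      then have "cmod (rGamma s) * cmod s ^ n \<le> cmod (rGamma s) * (cmod (pochhammer z n) * exp (cmod s))"
        by (intro mult_left_mono) auto
      also have "\<dots> = cmod (rGamma z) * exp (cmod s)"
        using pochhammer_rGamma[of z n] z(4) by (simp add: norm_mult mult_ac)
      also have "\<dots> \<le> C * exp (pi * cmod z) * exp (cmod s)"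
        using strip z by (intro mult_right_mono) auto
      also have "\<dots> \<le> C * exp (pi * cmod s) * exp (cmod s)"
        using \<open>cmod z \<le> cmod s\<close> C by auto
      finally have "cmod (rGamma s) * exp (real n * l) \<le> C * exp ((pi + 1) * cmod s)"
        unfolding lpow by (simp add: exp_add distrib_left distrib_right mult_ac)
      then have "cmod (rGamma s) \<le> C * exp ((pi + 1) * cmod s) * exp (- (real n * l))"
        by (simp add: exp_minus field_simps)
      also have "\<dots> = C * exp ((pi + 1) * cmod s - real n * l)"
        by (simp add: exp_diff exp_minus field_simps)
      also have "\<dots> \<le> C * exp (K + (K * cmod s - Re s * l))"
      proof -
        have "Re s * l \<le> (real n + 2) * l" using l z by (intro mult_right_mono) auto
        then have "(pi + 1) * cmod s - real n * l \<le> K + (K * cmod s - Re s * l)"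
          using l s pi_gt3 mult_nonneg_nonneg[of pi "cmod s"] unfolding K_def distrib_right by linarith
        then show ?thesis using C by simp
      qed
      finally show ?thesis by (simp add: l_def exp_add mult_ac)
    next
      case False
      \<comment> \<open>Adding this n brings the real part into (1, 2].\<close>
      define n where "n = nat (2 - \<lceil>Re s\<rceil>)"
      have n: "real n = 2 - of_int \<lceil>Re s\<rceil>" using False by (simp add: n_def ceiling_le_iff)
      have n': "real n \<le> 2 - Re s" using n by linarith
      have n2: "real n \<le> cmod s + 2" using n' abs_Re_le_cmod[of s] by linarith
      have z: "1 \<le> Re (s + of_nat n)" "Re (s + of_nat n) \<le> 2"
        using n by simp_all linarith+
      have "cmod (pochhammer s n) \<le> (cmod s + real n) ^ n" by (rule norm_pochhammer_le_power)
      \<comment> \<open>|s| + n \<le> 2|s| + 2 \<le> 4|s| because |s| \<ge> 1; the constant is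
        written as \<open>exp 4\<close> so that its power stays an exponential.\<close>
      also have "\<dots> \<le> (exp 4 * cmod s) ^ n"
      proof (rule power_mono)
        have "4 * cmod s \<le> exp 4 * cmod s"
          using exp_ge_add_one_self[of 4] by (intro mult_right_mono) auto
        then show "cmod s + real n \<le> exp 4 * cmod s" using n2 s by linarith
      qed simp
      also have "\<dots> = exp (4 * real n + real n * l)"
        using exp_of_nat_mult[of n "4::real"]
        by (simp only: power_mult_distrib lpow exp_add mult.commute[of 4])
      finally have "cmod (pochhammer s n) \<le> exp (4 * real n + real n * l)" .
      moreover have "cmod (rGamma (s + of_nat n)) \<le> C * exp (pi * cmod (s + of_nat n))"
        using strip z by simp
      ultimately have "cmod (rGamma s) \<le> exp (4 * real n + real n * l) * (C * exp (pi * cmod (s + of_nat n)))"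
        unfolding pochhammer_rGamma[of s n] norm_mult by (intro mult_mono) auto
      also have "\<dots> = C * exp (4 * real n + real n * l + pi * cmod (s + of_nat n))"
        by (simp add: exp_add mult_ac)
      also have "\<dots> \<le> C * exp (K + (K * cmod s - Re s * l))"
      proof -
        have "cmod (s + of_nat n) \<le> 2 * cmod s + 2"
          using norm_triangle_ineq[of s "of_nat n"] n2 by simp
        then have "pi * cmod (s + of_nat n) \<le> 2 * (pi * cmod s) + 2 * pi"
          using mult_left_mono[of "cmod (s + of_nat n)" "2 * cmod s + 2" pi] by (simp add: algebra_simps)
        moreover have "real n * l \<le> (2 - Re s) * l" using n' l by (intro mult_right_mono)
        ultimately have "4 * real n + real n * l + pi * cmod (s + of_nat n) \<le> K + (K * cmod s - Re s * l)"
          using l s n2 pi_gt3 mult_nonneg_nonneg[of pi "cmod s"]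
          unfolding K_def distrib_right left_diff_distrib by linarith
        then show ?thesis using C by simp
      qed
      finally show ?thesis by (simp add: l_def exp_add mult_ac)
    qed
  qed
qed

section \<open>The Gaussian on the plane\<close>

text \<open>The Gaussian is a product over the real basis {1, i}, and each factor is a multiple of
  the standard normal density.\<close>

lemma integrable_gaussian_complex: "integrable lborel (\<lambda>z::complex. exp (- (cmod z)\<^sup>2 / 2))"
proof (rule integrableI_nonneg)
  have g: "(\<integral>\<^sup>+x. ennreal (exp (- x\<^sup>2 / 2)) \<partial>lborel) < \<infinity>"
  proof -
    have "integrable lborel (\<lambda>x. sqrt (2 * pi) * normal_density 0 1 x)" by simp
    moreover have "(\<lambda>x. sqrt (2 * pi) * normal_density 0 1 x) = (\<lambda>x. exp (- x\<^sup>2 / 2))"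
      by (auto simp: normal_density_def)
    ultimately show ?thesis
      by (auto simp: integrable_iff_bounded)
  qed
  have "ennreal (exp (- (cmod z)\<^sup>2 / 2)) = ennreal (\<Prod>b\<in>Basis. exp (- (z \<bullet> b)\<^sup>2 / 2))" for z :: complex
    by (simp add: Basis_complex_def cmod_power2 exp_add[symmetric] add_divide_distrib)
  then have e: "ennreal (exp (- (cmod z)\<^sup>2 / 2)) = (\<Prod>b\<in>Basis. ennreal (exp (- (z \<bullet> b)\<^sup>2 / 2)))" for z :: complex
    by (simp add: prod_ennreal)
  show "(\<integral>\<^sup>+z. ennreal (exp (- (cmod z)\<^sup>2 / 2)) \<partial>(lborel::complex measure)) < \<infinity>"
    unfolding e by (subst nn_integral_lborel_prod) (use g in \<open>auto simp: Basis_complex_def ennreal_mult_less_top\<close>)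
qed auto

section \<open>A criterion for infinite dimension\<close>

lemma sum_fun_apply: "(\<Sum>i\<in>A. f i) x = (\<Sum>i\<in>A. f i x)"
  by (induction A rule: infinite_finite_induct) (auto simp: zero_fun_def plus_fun_def)

text \<open>A linear relation among the z^n u(z) makes a polynomial vanish wherever u does not. That
  set is infinite, so all coefficients are 0, and the modes exceed any finite spanning set in
  number.\<close>

lemma infinite_dimensional_zero_modesI:
  assumes u: "\<And>n. (\<lambda>z. z ^ n * u z) \<in> zero_modes F" and inf: "infinite {z. u z \<noteq> 0}"
  shows "infinite_dimensional (zero_modes F)"
  unfolding infinite_dimensional_def
proof (intro conjI notI subspace_zero_modes)
  assume "\<exists>B. finite B \<and> B \<subseteq> zero_modes F \<and> zero_modes F \<subseteq> cfun.span B"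
  then obtain B where B: "finite B" "zero_modes F \<subseteq> cfun.span B" by blast
  define g where "g = (\<lambda>n::nat. \<lambda>z. z ^ n * u z)"
  have lin: "c i = 0" if "(\<Sum>n\<le>m. fun_scale (c n) (g n)) = 0" "i \<le> m" for c m i
  proof -
    have "(\<Sum>n\<le>m. c n * z ^ n) = 0" if "u z \<noteq> 0" for z
    proof -
      have "(\<Sum>n\<le>m. c n * z ^ n) * u z = (\<Sum>n\<le>m. fun_scale (c n) (g n)) z"
        by (simp add: sum_fun_apply fun_scale_def g_def sum_distrib_right mult.assoc)
      then show ?thesis using \<open>(\<Sum>n\<le>m. fun_scale (c n) (g n)) = 0\<close> that by (simp add: zero_fun_def)
    qed
    then have "{z. u z \<noteq> 0} \<subseteq> {z. (\<Sum>n\<le>m. c n * z ^ n) = 0}" by blast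
    then have "infinite {z. (\<Sum>n\<le>m. c n * z ^ n) = 0}" using inf finite_subset by blast
    then show ?thesis using polyfun_finite_roots[of c m] that(2) by blast
  qed
  \<comment> \<open>Independence is a property of sets, so the modes must also be pairwise distinct
    to be counted.\<close>
  have inj: "inj g"
  proof (rule injI, rule ccontr)
    fix i j assume ij: "g i = g j" "i \<noteq> j"
    define c where "c = (\<lambda>n. if n = i then 1 else if n = j then - 1 else (0::complex))"
    have "(\<Sum>n\<le>max i j. fun_scale (c n) (g n)) = (\<Sum>n\<in>{i, j}. fun_scale (c n) (g n))"
      by (rule sum.mono_neutral_right) (auto simp: c_def fun_scale_def zero_fun_def)
    also have "\<dots> = 0"
      using ij by (auto simp: c_def fun_scale_def zero_fun_def plus_fun_def)
    finally show False using lin[where m = "max i j" and c = c and i = i] by (simp add: c_def)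
  qed
  \<comment> \<open>The index set \<open>{..card B}\<close> has \<open>card B + 1\<close> elements,
    one more than the span of \<open>B\<close> allows.\<close>
  have "cfun.independent (g ` {..card B})"
  proof (rule cfun.independent_if_scalars_zero)
    fix f x assume "(\<Sum>x\<in>g ` {..card B}. fun_scale (f x) x) = 0" "x \<in> g ` {..card B}"
    then show "f x = 0"
      using lin[where m = "card B" and c = "\<lambda>n. f (g n)"] inj by (auto simp: sum.reindex inj_on_subset)
  qed simp
  moreover have "g ` {..card B} \<subseteq> cfun.span B"
    using u B by (auto simp: g_def)
  ultimately have "card (g ` {..card B}) \<le> card B"
    using cfun.independent_span_bound[OF B(1)] by blast
  then show False using inj by (simp add: card_image inj_on_subset)
qed

section \<open>Auxiliary estimates for the potential and domination by a Gaussian\<close>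

lemma sector_phi_ge:
  assumes "b1 < 0" "0 \<le> \<alpha>"
  shows "(Im z)\<^sup>2 - sector_phi \<alpha> b1 z \<le> (1 - b1) * \<alpha>\<^sup>2 * (cmod z)\<^sup>2"
proof (cases "z \<in> sector \<alpha>")
  case True
  then have z: "0 < Arg z" "Arg z < \<alpha>" by (auto simp: sector_def)
  have "Im z = cmod z * sin (Arg z)"
    by (metis Im_rcis rcis_cmod_Arg)
  moreover have "\<bar>sin (Arg z)\<bar> \<le> \<alpha>"
    using abs_sin_x_le_abs_x[of "Arg z"] z by linarith
  ultimately have "\<bar>Im z\<bar> \<le> cmod z * \<alpha>"
    by (simp add: abs_mult mult_left_mono)
  then have "(Im z)\<^sup>2 \<le> \<alpha>\<^sup>2 * (cmod z)\<^sup>2"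
    by (metis abs_ge_zero power2_abs power_mono power_mult_distrib mult.commute)
  then have "(1 - b1) * (Im z)\<^sup>2 \<le> (1 - b1) * (\<alpha>\<^sup>2 * (cmod z)\<^sup>2)"
    using assms by (intro mult_left_mono) auto
  then show ?thesis using True by (simp add: sector_phi_def algebra_simps)
next
  case False
  then show ?thesis using assms by (simp add: sector_phi_def)
qed

text \<open>The inequality ln x \<le> x - 1 is applied at x = 1 / sqrt a. The resulting square root
  determines how small \<alpha> has to be.\<close>

lemma mult_neg_ln_le_sqrt:
  fixes a :: real
  assumes "0 < a"
  shows "- (a * ln a) \<le> 2 * sqrt a"
proof -
  have "- ln (sqrt a) \<le> 1 / sqrt a - 1"
    using ln_le_minus_one[of "1 / sqrt a"] assms by (simp add: ln_div)
  then have "- ln a \<le> 2 / sqrt a"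
    using assms by (simp add: ln_sqrt)
  then have "a * (- ln a) \<le> a * (2 / sqrt a)"
    using assms by (intro mult_left_mono) auto
  also have "a * (2 / sqrt a) = 2 * sqrt a"
    using assms by (simp add: real_div_sqrt field_simps)
  finally show ?thesis by simp
qed

text \<open>On the disc of radius \<open>R\<close>, compactness bounds f exp (|z|^2 / 2); hence one
  multiple of the Gaussian dominates f on the whole plane.\<close>

lemma integrable_continuous_gaussian_bound:
  fixes f :: "complex \<Rightarrow> real"
  assumes "continuous_on UNIV f"
    and "\<And>z. cmod z \<ge> R \<Longrightarrow> \<bar>f z\<bar> \<le> C * exp (- (cmod z)\<^sup>2 / 2)"
  shows "integrable lebesgue f"
proof -
  have "compact ((\<lambda>z. f z * exp ((cmod z)\<^sup>2 / 2)) ` cball 0 R)"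
    by (intro compact_continuous_image continuous_intros continuous_on_subset[OF assms(1)]) auto
  then have "bounded ((\<lambda>z. f z * exp ((cmod z)\<^sup>2 / 2)) ` cball 0 R)"
    by (rule compact_imp_bounded)
  then obtain M where M: "\<And>z. cmod z \<le> R \<Longrightarrow> \<bar>f z * exp ((cmod z)\<^sup>2 / 2)\<bar> \<le> M"
    by (force simp: bounded_iff)
  have [measurable]: "f \<in> borel_measurable borel"
    using assms(1) by (rule borel_measurable_continuous_onI)
  have "integrable lborel (\<lambda>z. max C M * exp (- (cmod z)\<^sup>2 / 2))"
    using integrable_gaussian_complex by simp
  then have "integrable lborel f"
  proof (rule Bochner_Integration.integrable_bound)
    show "AE z in lborel. norm (f z) \<le> norm (max C M * exp (- (cmod z)\<^sup>2 / 2))"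
    proof (rule AE_I2)
      fix z
      have "\<bar>f z\<bar> \<le> max C M * exp (- (cmod z)\<^sup>2 / 2)"
      proof (cases "cmod z \<ge> R")
        case True
        have "C * exp (- (cmod z)\<^sup>2 / 2) \<le> max C M * exp (- (cmod z)\<^sup>2 / 2)"
          by (intro mult_right_mono) auto
        with assms(2)[OF True] show ?thesis by linarith
      next
        case False
        then have "\<bar>f z\<bar> * exp ((cmod z)\<^sup>2 / 2) \<le> max C M"
          using M[of z] by (simp add: abs_mult)
        then show ?thesis by (simp add: exp_minus field_simps)
      qed
      then show "norm (f z) \<le> norm (max C M * exp (- (cmod z)\<^sup>2 / 2))"
        by simp
    qed
  qed measurable
  then show ?thesis by (simp add: integrable_completion)
qed

section \<open>Choice of \<delta> and construction of the zero modes\<close>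

theorem theorem3p1:
  shows "\<exists>\<delta>>0. \<forall>\<alpha>\<in>{0<..<\<delta>}. \<forall>b1\<in>{-\<delta><..<0}.
           infinite_dimensional (zero_modes (sector_potential \<alpha> b1))"
proof -
  obtain C K where CK: "C > 0" "K > 0"
    and G: "\<And>s::complex. cmod s \<ge> 1 \<Longrightarrow> cmod (rGamma s) \<le> C * exp (K * cmod s - Re s * ln (cmod s))"
    using norm_rGamma_le by blast
  \<comment> \<open>Every error below is a multiple of q |z|^2: K from the Gamma bound, 18 from the
    imaginary part of the logarithm, 2 from a ln a and 2 from the sector. This \<open>q\<close>
    makes their sum |z|^2 / 8; it depends on the Gamma bound alone, hence is uniform in \<alpha> and
    \<open>b1\<close>.\<close>
  define q where "q = 1 / (8 * (K + 22))"
  have q: "0 < q" "q \<le> 1" "(K + 22) * q = 1 / 8" using CK by (auto simp: q_def field_simps)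
  \<comment> \<open>The witness is q^2 rather than q because a ln a is only O(sqrt a), and a \<le>
    \<alpha> < q^2 yields sqrt a \<le> q.\<close>
  show ?thesis
  proof (intro exI[of _ "q\<^sup>2"] conjI ballI)
    show "q\<^sup>2 > 0" using q by simp
    fix \<alpha> b1 :: real
    assume \<alpha>: "\<alpha> \<in> {0<..<q\<^sup>2}" and b1: "b1 \<in> {- q\<^sup>2<..<0}"
    have "q\<^sup>2 \<le> q" using q by (simp add: power2_eq_square)
    then have \<alpha>': "0 < \<alpha>" "\<alpha> \<le> q" "\<alpha> \<le> 1" "\<alpha> < pi" and b1': "b1 < 0" "1 - b1 \<le> 2"
      using \<alpha> b1 q pi_gt3 by auto
    define c where "c = (1 - b1) * sin \<alpha> / (2 * pi)"
    \<comment> \<open>Since ln (a r^2) = ln a + 2 ln r, halving \<open>c\<close> makes the two terms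
      c Re (w^2) ln r cancel exactly.\<close>
    define a where "a = c / 2"
    have "sin \<alpha> > 0" using \<alpha>' by (simp add: sin_gt_zero)
    then have a0: "a > 0" using b1' by (simp add: a_def c_def)
    have "(1 - b1) * sin \<alpha> \<le> 2 * \<alpha>"
      using \<open>sin \<alpha> > 0\<close> b1' sin_x_le_x[of \<alpha>] \<alpha>' by (intro mult_mono) auto
    also have "\<dots> \<le> (2 * \<alpha>) * (2 * pi)" using \<alpha>' pi_gt3 by simp
    finally have "c \<le> 2 * \<alpha>" by (simp add: c_def field_simps)
    then have "a \<le> \<alpha>" by (simp add: a_def)
    then have aq: "a \<le> q" using \<alpha>' by simp
    have "sqrt a \<le> q"
      using \<open>a \<le> \<alpha>\<close> \<alpha> q by (intro real_le_lsqrt) auto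
    moreover have "a * ln a \<le> 0"
      using a0 aq q by (simp add: mult_le_0_iff)
    ultimately have aln: "\<bar>a * ln a\<bar> \<le> 2 * q"
      using mult_neg_ln_le_sqrt[OF a0] by linarith
    define u where "u = (\<lambda>z. exp (- z\<^sup>2 / 2) * rGamma (of_real a * (z * cis (- \<alpha> / 2))\<^sup>2))"
    define F where "F = sector_potential \<alpha> b1"
    \<comment> \<open>The region is exactly where the argument of \<open>rGamma\<close> has modulus
      at least 1. The exponent 3/8 is 1/2 minus the total error 1/8.\<close>
    have bound: "cmod (u z) * exp (- F z) \<le> C * exp (- 3 / 8 * (cmod z)\<^sup>2)"
      if z: "cmod z \<ge> 1 / sqrt a" for z
    proof -
      define r where "r = cmod z"
      define w2 where "w2 = (z * cis (- \<alpha> / 2))\<^sup>2"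
      define s where "s = of_real a * w2"
      have "0 < 1 / sqrt a" using a0 by simp
      then have r: "r > 0" using z unfolding r_def by linarith
      have w2: "cmod w2 = r\<^sup>2" by (simp add: w2_def r_def norm_power norm_mult)
      have s: "cmod s = a * r\<^sup>2" "Re s = a * Re w2"
        using a0 by (simp_all add: s_def norm_mult w2)
      have "(1 / sqrt a)\<^sup>2 \<le> r\<^sup>2" using z a0 unfolding r_def by (intro power_mono) auto
      then have s1: "cmod s \<ge> 1" using a0 by (simp add: s power_divide field_simps)
      have ln: "ln (cmod s) = ln a + 2 * ln r"
        using a0 r by (simp add: s ln_mult ln_realpow)
      have "- F z = - sector_phi \<alpha> b1 z + c * (Re w2 * ln r)
          + c * (- Im w2 * Im (log_branch \<alpha> z))"
        by (simp add: F_def sector_potential_def c_def w2_def r_def log_branch_def algebra_simps)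
      \<comment> \<open>The argument lies in [\<alpha>, \<alpha> + 2 pi), with \<alpha> \<le> 1 and
        pi < 4.\<close>
      moreover have "c * (- Im w2 * Im (log_branch \<alpha> z)) \<le> c * (r\<^sup>2 * (1 + 2 * 4))"
      proof -
        have "\<bar>Im w2\<bar> * \<bar>Im (log_branch \<alpha> z)\<bar> \<le> r\<^sup>2 * (1 + 2 * 4)"
          using abs_Im_le_cmod[of w2] Im_log_branch[of \<alpha> z] \<alpha>' pi_less_4 w2
          by (intro mult_mono) auto
        then have "- Im w2 * Im (log_branch \<alpha> z) \<le> r\<^sup>2 * (1 + 2 * 4)"
          by (metis abs_mult abs_le_iff mult_minus_left)
        then show ?thesis using a0 by (intro mult_left_mono) (auto simp: a_def)
      qed
      moreover have "- (Re w2 * (a * ln a)) \<le> r\<^sup>2 * (2 * q)"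
      proof -
        have "\<bar>Re w2\<bar> * \<bar>a * ln a\<bar> \<le> r\<^sup>2 * (2 * q)"
          using abs_Re_le_cmod[of w2] aln q w2 by (intro mult_mono) auto
        then show ?thesis by (metis abs_mult abs_le_iff)
      qed
      moreover have "(Im z)\<^sup>2 - sector_phi \<alpha> b1 z \<le> 2 * q * r\<^sup>2"
      proof -
        have "(1 - b1) * \<alpha>\<^sup>2 \<le> 2 * q"
        proof (rule mult_mono)
          have "\<alpha>\<^sup>2 \<le> q\<^sup>2" using \<alpha>' by (intro power_mono) auto
          with \<open>q\<^sup>2 \<le> q\<close> show "\<alpha>\<^sup>2 \<le> q" by simp
        qed (use b1' in auto)
        then have "(1 - b1) * \<alpha>\<^sup>2 * r\<^sup>2 \<le> 2 * q * r\<^sup>2" by (intro mult_right_mono) auto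
        then show ?thesis using sector_phi_ge[OF b1'(1), of \<alpha> z] \<alpha>' by (simp add: r_def)
      qed
      moreover have "- Re (z\<^sup>2) / 2 = (Im z)\<^sup>2 - r\<^sup>2 / 2"
        by (simp add: r_def cmod_power2 Re_power2 field_simps)
      moreover have "K * a * r\<^sup>2 \<le> K * q * r\<^sup>2" "a * r\<^sup>2 \<le> q * r\<^sup>2"
        using aq CK by (auto intro!: mult_right_mono mult_left_mono)
      moreover have "K * q * r\<^sup>2 + 22 * (q * r\<^sup>2) = r\<^sup>2 / 8"
        using q(3) by (metis distrib_right mult.assoc mult.commute times_divide_eq_right mult_1)
      moreover have "c * (r\<^sup>2 * (1 + 2 * 4)) = 18 * (a * r\<^sup>2)" by (simp add: a_def)
      moreover have "Re s * ln (cmod s) = Re w2 * (a * ln a) + c * (Re w2 * ln r)"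
        unfolding ln s(2) by (simp add: a_def algebra_simps)
      moreover have "K * cmod s = K * a * r\<^sup>2" by (simp add: s)
      moreover have "r\<^sup>2 * (2 * q) = 2 * (q * r\<^sup>2)" "2 * q * r\<^sup>2 = 2 * (q * r\<^sup>2)" by simp_all
      \<comment> \<open>The facts collected express all products through common terms. The terms in
        ln r cancel, and what remains is at most - r^2 / 2 + (K + 22) q r^2.\<close>
      ultimately have e: "- Re (z\<^sup>2) / 2 + (K * cmod s - Re s * ln (cmod s)) + - F z \<le> - 3 / 8 * r\<^sup>2"
        by linarith
      have "cmod (u z) * exp (- F z) = exp (- Re (z\<^sup>2) / 2) * cmod (rGamma s) * exp (- F z)"
        by (simp add: u_def s_def w2_def norm_mult)
      also have "\<dots> \<le> exp (- Re (z\<^sup>2) / 2) * (C * exp (K * cmod s - Re s * ln (cmod s))) * exp (- F z)"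
        using G[OF s1] by (intro mult_right_mono mult_left_mono) auto
      also have "\<dots> = C * exp (- Re (z\<^sup>2) / 2 + (K * cmod s - Re s * ln (cmod s)) + - F z)"
        by (simp only: exp_add mult_ac)
      also have "\<dots> \<le> C * exp (- 3 / 8 * r\<^sup>2)" using e CK by simp
      finally show ?thesis by (simp add: r_def)
    qed
    have hol: "u holomorphic_on UNIV"
      unfolding u_def by (intro holomorphic_intros) auto
    have contF: "continuous_on UNIV F"
      unfolding F_def using \<alpha>' by (intro continuous_on_sector_potential)
    show "infinite_dimensional (zero_modes (sector_potential \<alpha> b1))"
      unfolding F_def[symmetric]
    proof (rule infinite_dimensional_zero_modesI)
      fix n
      define v where "v = (\<lambda>z. z ^ n * u z * of_real (exp (- F z)))"
      have cv: "continuous_on UNIV v"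
        unfolding v_def by (intro continuous_intros contF holomorphic_on_imp_continuous_on hol)
      have "integrable lebesgue (\<lambda>z. (cmod (v z))\<^sup>2)"
      proof (rule integrable_continuous_gaussian_bound)
        show "continuous_on UNIV (\<lambda>z. (cmod (v z))\<^sup>2)" by (intro continuous_intros cv)
        fix z :: complex assume z: "cmod z \<ge> 1 / sqrt a"
        \<comment> \<open>Dividing by 4 leaves room in the exponent: after squaring
          \<open>bound\<close>, 1/4 - 2 * 3/8 = - 1/2.\<close>
        have "((cmod z)\<^sup>2 / 4) ^ n \<le> fact n * exp ((cmod z)\<^sup>2 / 4)"
          by (rule pow_le_fact_exp) simp
        then have p: "(cmod z ^ n)\<^sup>2 \<le> 4 ^ n * fact n * exp ((cmod z)\<^sup>2 / 4)"
          by (simp add: power_divide power_mult[symmetric] field_simps)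
        have "(cmod (v z))\<^sup>2 = (cmod z ^ n)\<^sup>2 * (cmod (u z) * exp (- F z))\<^sup>2"
          by (simp add: v_def norm_mult norm_power power_mult_distrib)
        also have "\<dots> \<le> (4 ^ n * fact n * exp ((cmod z)\<^sup>2 / 4)) * (C * exp (- 3 / 8 * (cmod z)\<^sup>2))\<^sup>2"
          by (rule mult_mono[OF p power_mono[OF bound[OF z]]]) auto
        also have "\<dots> = (4 ^ n * fact n * C\<^sup>2) * (exp ((cmod z)\<^sup>2 / 4) * exp (- 3 / 8 * (cmod z)\<^sup>2) ^ 2)"
          by (simp add: power_mult_distrib)
        also have "exp ((cmod z)\<^sup>2 / 4) * exp (- 3 / 8 * (cmod z)\<^sup>2) ^ 2 = exp (- (cmod z)\<^sup>2 / 2)"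
          by (simp only: power2_eq_square exp_add[symmetric]) (simp add: field_simps)
        finally show "\<bar>(cmod (v z))\<^sup>2\<bar> \<le> (4 ^ n * fact n * C\<^sup>2) * exp (- (cmod z)\<^sup>2 / 2)"
          by simp
      qed
      moreover have "v \<in> borel_measurable lebesgue"
        using borel_measurable_continuous_onI[OF cv] by (simp add: measurable_completion)
      ultimately have "in_L2 v" by (simp add: in_L2_def)
      then show "(\<lambda>z. z ^ n * u z) \<in> zero_modes F"
        using hol by (auto simp: zero_modes_def v_def intro!: holomorphic_intros)
    next
      \<comment> \<open>On the bisector of the sector the rotated variable is real and positive, so
        the argument of \<open>rGamma\<close> is positive and misses its zeros, the nonpositive
        integers.\<close>
      define ray where "ray = (\<lambda>t::real. of_real t * cis (\<alpha> / 2))"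
      have "inj ray" by (auto simp: inj_def ray_def)
      then have "infinite (ray ` {0<..})"
        using infinite_Ioi[of "0::real"] finite_imageD inj_on_subset by blast
      moreover have "ray ` {0<..} \<subseteq> {z. u z \<noteq> 0}"
      proof clarify
        fix t :: real assume t: "t > 0" "u (ray t) = 0"
        have "of_real a * (ray t * cis (- \<alpha> / 2))\<^sup>2 = complex_of_real (a * t\<^sup>2)"
          by (simp add: ray_def mult.assoc cis_mult)
        moreover have "a * t\<^sup>2 > 0" using a0 t by simp
        then have "complex_of_real (a * t\<^sup>2) \<notin> \<int>\<^sub>\<le>\<^sub>0"
          by (auto simp only: of_real_in_nonpos_Ints_iff elim!: nonpos_Ints_cases)
        ultimately have "rGamma (of_real a * (ray t * cis (- \<alpha> / 2))\<^sup>2) \<noteq> 0"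
          by (simp only: rGamma_eq_zero_iff not_False_eq_True)
        then show False using t(2) by (simp add: u_def)
      qed
      ultimately show "infinite {z. u z \<noteq> 0}" using finite_subset by blast
    qed
  qed
qed

end
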